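(* Let $\mathcal{X}$ and $\mathcal{Y}$ be finite alphabets and let $P_{XY}$ be any joint distribution on $\mathcal{X}\times\mathcal{Y}$. Then the maximal leakage from $X$ to $Y$ equals the Sibson mutual information of order infinity: $$\mathcal{L}(X\to Y)=\log\sum_{y\in\mathcal{Y}}\ \max_{x\in\mathcal{X}:\,P_X(x)>0}P_{Y|X}(y|x)=I_\infty(X;Y).$$
   Context: $\log$ is the natural logarithm. The notation $U-X-Y-\hat U$ means that these random variables form a Markov chain in this order. The maximal leakage from $X$ to $Y$ is $$\mathcal{L}(X\to Y)=\sup_{U-X-Y-\hat U}\log\frac{\Pr(U=\hat U)}{\max_{u\in\mathcal{U}}P_U(u)},$$ where the supremum is over all $U$ and $\hat U$ taking values in the same finite, but arbitrary, alphabet $\mathcal{U}$ (the joint law of $(X,Y)$ being the given $P_{XY}$). The Sibson mutual information of order infinity is $I_\infty(X;Y)=\inf_{Q_Y}D_\infty(P_{XY}\|P_X\times Q_Y)$, the infimum being over probability distributions $Q_Y$ on $\mathcal{Y}$, where $D_\infty(P\|Q)=\log\sup_a \frac{P(a)}{Q(a)}$ (supremum over $a$ with $P(a)>0$, with $p/0=+\infty$ for $p>0$). *)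

theory Defs
  imports "HOL-Probability.Probability"
begin

text \<open>
  The natural logarithm on \<open>[0, \<infinity>]\<close>, with \<open>log 0 = -\<infinity>\<close> and \<open>log \<infinity> = \<infinity>\<close>
  (whereas \<^const>\<open>ln\<close> maps the real number 0 to 0).
\<close>
definition eln :: "ennreal \<Rightarrow> ereal" where
  "eln a = (if a = 0 then -\<infinity> else if a = \<infinity> then \<infinity> else ereal (ln (enn2real a)))"

text \<open>
  \<open>A - B - C\<close>: given \<open>B\<close>, the conditional law of \<open>C\<close> does not change when one conditions on \<open>A\<close>
  in addition. The chain \<open>A - B - C - D\<close> requires this at every step, with the whole past
  \<open>(A, B)\<close> in place of \<open>A\<close> at the last one.
\<close>
definition markov_chain3 :: "'w pmf \<Rightarrow> ('w \<Rightarrow> 'a) \<Rightarrow> ('w \<Rightarrow> 'b) \<Rightarrow> ('w \<Rightarrow> 'c) \<Rightarrow> bool" where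
  "markov_chain3 R A B C \<longleftrightarrow>
     (\<forall>a b c. \<P>(w in measure_pmf R. A w = a \<and> B w = b) > 0 \<longrightarrow>
        \<P>(w in measure_pmf R. C w = c \<bar> A w = a \<and> B w = b) =
        \<P>(w in measure_pmf R. C w = c \<bar> B w = b))"

definition markov_chain4 ::
  "'w pmf \<Rightarrow> ('w \<Rightarrow> 'a) \<Rightarrow> ('w \<Rightarrow> 'b) \<Rightarrow> ('w \<Rightarrow> 'c) \<Rightarrow> ('w \<Rightarrow> 'd) \<Rightarrow> bool" where
  "markov_chain4 R A B C D \<longleftrightarrow>
     markov_chain3 R A B C \<and> markov_chain3 R (\<lambda>w. (A w, B w)) C D"

text \<open>
  The supremum ranges over all joint laws \<open>R\<close> of \<open>(U, X, Y, U')\<close> in which \<open>(X, Y)\<close> has law \<open>P\<close>.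
  Every finite alphabet is in bijection with a finite set \<open>S\<close> of natural numbers, so these
  represent the arbitrary finite alphabets. \<open>S\<close> is nonempty because it carries a distribution.
\<close>
definition maximal_leakage :: "('x \<times> 'y) pmf \<Rightarrow> ereal" where
  "maximal_leakage P =
     Sup {eln (ennreal (\<P>((u, x, y, u') in measure_pmf R. u = u') /
                        (MAX u\<in>S. pmf (map_pmf fst R) u))) |
          (R :: (nat \<times> 'x \<times> 'y \<times> nat) pmf) S.
            finite S \<and> set_pmf R \<subseteq> S \<times> UNIV \<times> UNIV \<times> S \<and>
            map_pmf (\<lambda>(u, x, y, u'). (x, y)) R = P \<and>
            markov_chain4 R (\<lambda>(u, x, y, u'). u) (\<lambda>(u, x, y, u'). x)
                            (\<lambda>(u, x, y, u'). y) (\<lambda>(u, x, y, u'). u')}"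

text \<open>Division is that of \<^typ>\<open>ennreal\<close>, where \<open>p / 0 = \<infinity>\<close> for \<open>p > 0\<close>.\<close>
definition renyi_divergence_inf :: "'a pmf \<Rightarrow> 'a pmf \<Rightarrow> ereal" where
  "renyi_divergence_inf P Q =
     eln (SUP a\<in>{a. pmf P a > 0}. ennreal (pmf P a) / ennreal (pmf Q a))"

definition sibson_information_inf :: "('x \<times> 'y) pmf \<Rightarrow> ereal" where
  "sibson_information_inf P =
     (INF Q. renyi_divergence_inf P (pair_pmf (map_pmf fst P) Q))"

text \<open>\<open>P\<^bsub>Y|X\<^esub>(y|x)\<close>\<close>
definition cond_pmf_snd :: "('x \<times> 'y) pmf \<Rightarrow> 'y \<Rightarrow> 'x \<Rightarrow> real" where
  "cond_pmf_snd P y x = \<P>(w in measure_pmf P. snd w = y \<bar> fst w = x)"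

end

theory Submission
  imports Defs
begin

text \<open>
  Write \<open>M y\<close> for the largest value of \<open>P\<^bsub>Y|X\<^esub>(y|x)\<close> over the support of \<open>X\<close>.

  The Markov chain bounds \<open>Pr(U = u, X = x, Y = y, U' = u)\<close> by
  \<open>Pr(U = u, X = x) M(y) Pr(U' = u | Y = y)\<close>; summing over \<open>x\<close>, \<open>u\<close> and \<open>y\<close> gives
  \<open>Pr(U = U') \<le> max P\<^sub>U * (\<Sum>y. M y)\<close>.

  The bound is attained. Let \<open>m\<close> be the smallest positive value of \<open>P\<^sub>X\<close>, and split each \<open>x\<close>
  in the support into an atom \<open>(x, 0)\<close> of mass exactly \<open>m\<close> and finitely many atoms of mass at most
  \<open>m\<close>. If \<open>U\<close> is this refinement of \<open>X\<close>, then \<open>max P\<^sub>U = m\<close>, and guessing \<open>(x, 0)\<close> with \<open>x\<close> a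
  maximum-likelihood estimate from \<open>Y\<close> is correct with probability \<open>m * (\<Sum>y. M y)\<close>.

  For the Sibson information, \<open>D\<^sub>\<infinity>(P || P\<^sub>X \<times> Q) \<le> log r\<close> says that \<open>M y \<le> r * Q y\<close> for all \<open>y\<close>.
  Summation gives \<open>(\<Sum>y. M y) \<le> r\<close>, with equality for \<open>Q\<close> proportional to \<open>M\<close>.
\<close>

section \<open>The extended logarithm and the maximum likelihood\<close>

lemma eln_mono: "a \<le> b \<Longrightarrow> eln a \<le> eln b"
proof -
  assume ab: "a \<le> b"
  show ?thesis
  proof (cases "a = 0 \<or> b = \<infinity>")
    case False
    then have "b \<noteq> 0" "a \<noteq> \<infinity>" using ab by (auto simp: top_unique)
    then have "0 < enn2real a" "enn2real a \<le> enn2real b"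
      using False ab
      by (auto simp: enn2real_positive_iff less_top zero_less_iff_neq_zero intro!: enn2real_mono)
    then show ?thesis using False \<open>b \<noteq> 0\<close> \<open>a \<noteq> \<infinity>\<close> by (auto simp: eln_def)
  qed (auto simp: eln_def)
qed

lemma eln_ennreal: "0 < r \<Longrightarrow> eln (ennreal r) = ereal (ln r)"
  by (auto simp: eln_def)

definition max_likelihood :: "('x \<times> 'y) pmf \<Rightarrow> 'y \<Rightarrow> real" where
  "max_likelihood P y = (MAX x\<in>{x. pmf (map_pmf fst P) x > 0}. cond_pmf_snd P y x)"

text \<open>Marginalisation with an event held fixed: the fibres of \<open>f\<close> over
  \<open>C\<close> are disjoint. It serves to sum out one coordinate of a joint law.\<close>

lemma sum_measure_pmf_fibers:
  assumes "finite C"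
  shows "(\<Sum>c\<in>C. measure (measure_pmf R) {w. B w \<and> f w = c}) = measure (measure_pmf R) {w. B w \<and> f w \<in> C}"
proof -
  have "(\<Sum>c\<in>C. measure (measure_pmf R) {w. B w \<and> f w = c})
      = measure (measure_pmf R) (\<Union>c\<in>C. {w. B w \<and> f w = c})"
    using assms by (intro measure_pmf.finite_measure_finite_Union[symmetric])
      (auto simp: disjoint_family_on_def)
  also have "(\<Union>c\<in>C. {w. B w \<and> f w = c}) = {w. B w \<and> f w \<in> C}" by auto
  finally show ?thesis .
qed

lemma pmf_map_conv_measure: "pmf (map_pmf f R) a = measure (measure_pmf R) {w. f w = a}"
  by (auto simp: pmf_map vimage_def)

lemma cond_prob_pmf:
  "\<P>(w in measure_pmf R. A w \<bar> B w)
   = measure (measure_pmf R) {w. A w \<and> B w} / measure (measure_pmf R) {w. B w}"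
  by (simp add: cond_prob_def)

text \<open>Holds off the support of X as well: there both quotients have denominator 0 and equal
  0.\<close>

lemma cond_pmf_snd_eq: "cond_pmf_snd P y x = pmf P (x, y) / pmf (map_pmf fst P) x"
proof -
  have "{w. snd w = y \<and> fst w = x} = {(x, y)}" by auto
  then show ?thesis
    by (simp add: cond_pmf_snd_def cond_prob_pmf pmf_map_conv_measure measure_pmf_single)
qed

lemma cond_pmf_snd_nonneg: "0 \<le> cond_pmf_snd P y x"
  by (simp add: cond_pmf_snd_eq)

lemma pmf_fst_pos: "0 < pmf P (x, y) \<Longrightarrow> 0 < pmf (map_pmf fst P) x"
  by (simp add: pmf_positive_iff) force

lemma pmf_pos_ex: "\<exists>x. 0 < pmf p x"
  using set_pmf_not_empty[of p] by (auto simp: pmf_positive_iff)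

lemma cond_le_max_likelihood:
  fixes P :: "('x::finite \<times> 'y) pmf"
  assumes "0 < pmf (map_pmf fst P) x"
  shows "cond_pmf_snd P y x \<le> max_likelihood P y"
  unfolding max_likelihood_def using assms by (intro Max_ge) auto

lemma max_likelihood_attained:
  fixes P :: "('x::finite \<times> 'y) pmf"
  shows "\<exists>x. 0 < pmf (map_pmf fst P) x \<and> max_likelihood P y = cond_pmf_snd P y x"
proof -
  have "max_likelihood P y \<in> cond_pmf_snd P y ` {x. pmf (map_pmf fst P) x > 0}"
    unfolding max_likelihood_def using pmf_pos_ex[of "map_pmf fst P"] by (intro Max_in) auto
  then show ?thesis by auto
qed

lemma max_likelihood_nonneg: "0 \<le> max_likelihood (P :: ('x::finite \<times> 'y) pmf) y"
  using max_likelihood_attained[of P y] cond_pmf_snd_nonneg[of P y] by auto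

lemma pmf_fst_eq_sum:
  fixes P :: "('x \<times> 'y::finite) pmf"
  shows "pmf (map_pmf fst P) x = (\<Sum>y\<in>UNIV. pmf P (x, y))"
proof -
  have "{w. fst w = x \<and> snd w = y} = {(x, y)}" for y :: 'y by auto
  then show ?thesis
    using sum_measure_pmf_fibers[of UNIV P "\<lambda>w. fst w = x" snd]
    by (simp add: pmf_map_conv_measure measure_pmf_single)
qed

text \<open>For any \<open>x\<close> of positive mass the conditional law given \<open>x\<close>
  sums to 1 and lies pointwise below \<open>max_likelihood P\<close>. Positivity makes the logarithm
  finite and lets the maxima be normalised to a distribution.\<close>

lemma sum_max_likelihood_pos:
  fixes P :: "('x::finite \<times> 'y::finite) pmf"
  shows "0 < (\<Sum>y\<in>UNIV. max_likelihood P y)"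
proof -
  obtain x where x: "0 < pmf (map_pmf fst P) x" using pmf_pos_ex[of "map_pmf fst P"] by auto
  have "1 = (\<Sum>y\<in>UNIV. cond_pmf_snd P y x)"
    using x by (simp add: cond_pmf_snd_eq sum_divide_distrib[symmetric] pmf_fst_eq_sum[symmetric])
  also have "\<dots> \<le> (\<Sum>y\<in>UNIV. max_likelihood P y)"
    using x by (intro sum_mono cond_le_max_likelihood)
  finally show ?thesis by linarith
qed

section \<open>Sibson information\<close>

lemma sum_max_likelihood_le_ratio:
  fixes P :: "('x::finite \<times> 'y::finite) pmf"
  shows "ennreal (\<Sum>y\<in>UNIV. max_likelihood P y)
     \<le> (SUP a\<in>{a. pmf P a > 0}. ennreal (pmf P a) / ennreal (pmf (pair_pmf (map_pmf fst P) Q) a))"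
    (is "_ \<le> ?s")
proof (cases ?s)
  case (real r)
  have le: "max_likelihood P y \<le> r * pmf Q y" for y
  proof -
    obtain x where x: "0 < pmf (map_pmf fst P) x" "max_likelihood P y = cond_pmf_snd P y x"
      using max_likelihood_attained[of P y] by auto
    show ?thesis
    proof (cases "pmf P (x, y) = 0")
      case True
      then show ?thesis using x real by (simp add: cond_pmf_snd_eq)
    next
      case False
      then have pos: "0 < pmf P (x, y)" by (simp add: pmf_pos)
      let ?q = "pmf (map_pmf fst P) x * pmf Q y"
      have "ennreal (pmf P (x, y)) / ennreal ?q \<le> ?s"
        using pos by (intro SUP_upper2[of "(x, y)"]) (auto simp: pmf_pair)
      then have *: "ennreal (pmf P (x, y)) / ennreal ?q \<le> ennreal r" using real by simp
      \<comment> \<open>A vanishing denominator would make the ratio infinite, against the finite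
        supremum \<open>r\<close>; hence \<open>Q\<close> charges \<open>y\<close>.\<close>
      have "?q \<noteq> 0"
        using * pos by (auto simp: ennreal_divide_zero top_unique)
      then have "0 < ?q" using less_eq_real_def by auto
      then have "pmf P (x, y) / ?q \<le> r" using * pos real by (simp add: divide_ennreal)
      \<comment> \<open>Dividing the joint mass by the mass of \<open>x\<close> leaves the
        conditional probability, which is the maximum by choice of \<open>x\<close>.\<close>
      then have "max_likelihood P y / pmf Q y \<le> r" by (simp add: x(2) cond_pmf_snd_eq)
      moreover have "0 < pmf Q y" using \<open>0 < ?q\<close> x(1) by (simp add: zero_less_mult_iff)
      ultimately show ?thesis by (simp add: divide_le_eq)
    qed
  qed
  have "(\<Sum>y\<in>UNIV. max_likelihood P y) \<le> (\<Sum>y\<in>UNIV. r * pmf Q y)" by (intro sum_mono le)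
  also have "\<dots> = r" by (simp add: sum_distrib_left[symmetric] sum_pmf_eq_1)
  finally show ?thesis using real by (simp add: ennreal_leI)
next
  case top
  then show ?thesis by (simp only: top_greatest)
qed

lemma ratio_le_sum_max_likelihood:
  fixes P :: "('x::finite \<times> 'y::finite) pmf"
  shows "\<exists>Q. (SUP a\<in>{a. pmf P a > 0}. ennreal (pmf P a) / ennreal (pmf (pair_pmf (map_pmf fst P) Q) a))
     \<le> ennreal (\<Sum>y\<in>UNIV. max_likelihood P y)"
proof -
  let ?L = "\<Sum>y\<in>UNIV. max_likelihood P y"
  note L = sum_max_likelihood_pos[of P]
  define Q where "Q = embed_pmf (\<lambda>y. max_likelihood P y / ?L)"
  have Q: "pmf Q y = max_likelihood P y / ?L" for y
    unfolding Q_def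
  proof (rule pmf_embed_pmf)
    show "0 \<le> max_likelihood P y / ?L" for y
      using L max_likelihood_nonneg by (rule divide_nonneg_pos[rotated])
    have "(\<integral>\<^sup>+y. ennreal (max_likelihood P y / ?L) \<partial>count_space UNIV)
        = (\<Sum>y\<in>UNIV. ennreal (max_likelihood P y / ?L))"
      by (simp add: nn_integral_count_space_finite)
    also have "\<dots> = ennreal (\<Sum>y\<in>UNIV. max_likelihood P y / ?L)"
      using L max_likelihood_nonneg by (intro sum_ennreal divide_nonneg_pos)
    also have "(\<Sum>y\<in>UNIV. max_likelihood P y / ?L) = 1"
      using L by (simp add: sum_divide_distrib[symmetric])
    finally show "(\<integral>\<^sup>+y. ennreal (max_likelihood P y / ?L) \<partial>count_space UNIV) = 1" by simp
  qed
  have "ennreal (pmf P a) / ennreal (pmf (pair_pmf (map_pmf fst P) Q) a) \<le> ennreal ?L"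
    if "0 < pmf P a" for a
  proof -
    obtain x y where a: "a = (x, y)" by (cases a)
    have x: "0 < pmf (map_pmf fst P) x" using that a pmf_fst_pos by auto
    have c: "0 < cond_pmf_snd P y x" using that a x by (simp add: cond_pmf_snd_eq)
    have le: "cond_pmf_snd P y x \<le> max_likelihood P y" using x by (rule cond_le_max_likelihood)
    let ?q = "pmf (map_pmf fst P) x * pmf Q y"
    \<comment> \<open>Where \<open>P\<close> charges \<open>(x, y)\<close>, the maximum at
      \<open>y\<close> is at least the positive conditional probability, so \<open>Q\<close> charges
      \<open>y\<close> too and no ratio is infinite.\<close>
    have q: "0 < ?q" using x c le L by (simp add: Q)
    have "pmf P a / ?q = cond_pmf_snd P y x / max_likelihood P y * ?L"
      by (simp add: Q a cond_pmf_snd_eq)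
    also have "\<dots> \<le> 1 * ?L" using L c le by (intro mult_right_mono) auto
    finally have "pmf P a / ?q \<le> ?L" by simp
    then show ?thesis using q that by (simp add: a pmf_pair divide_ennreal ennreal_leI)
  qed
  then show ?thesis by (intro exI[of _ Q] SUP_least) auto
qed

lemma sibson_information_inf_eq:
  fixes P :: "('x::finite \<times> 'y::finite) pmf"
  shows "sibson_information_inf P = ereal (ln (\<Sum>y\<in>UNIV. max_likelihood P y))"
proof (rule antisym)
  obtain Q where "(SUP a\<in>{a. pmf P a > 0}. ennreal (pmf P a) / ennreal (pmf (pair_pmf (map_pmf fst P) Q) a))
     \<le> ennreal (\<Sum>y\<in>UNIV. max_likelihood P y)"
    using ratio_le_sum_max_likelihood by blast
  from eln_mono[OF this]
  have "renyi_divergence_inf P (pair_pmf (map_pmf fst P) Q) \<le> ereal (ln (\<Sum>y\<in>UNIV. max_likelihood P y))"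
    by (simp add: renyi_divergence_inf_def eln_ennreal sum_max_likelihood_pos)
  then show "sibson_information_inf P \<le> ereal (ln (\<Sum>y\<in>UNIV. max_likelihood P y))"
    unfolding sibson_information_inf_def by (intro INF_lower2[of Q]) auto
  show "ereal (ln (\<Sum>y\<in>UNIV. max_likelihood P y)) \<le> sibson_information_inf P"
    unfolding sibson_information_inf_def renyi_divergence_inf_def
    using eln_mono[OF sum_max_likelihood_le_ratio[of P]]
    by (intro INF_greatest) (simp add: eln_ennreal sum_max_likelihood_pos)
qed

section \<open>Upper bound on the leakage\<close>

lemma guess_prob_le:
  fixes R :: "('u \<times> 'x::finite \<times> 'y::finite \<times> 'u) pmf"
  assumes S: "finite S" "set_pmf R \<subseteq> S \<times> UNIV \<times> UNIV \<times> S"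
    and P: "map_pmf (\<lambda>(u, x, y, u'). (x, y)) R = P"
    and mc: "markov_chain4 R (\<lambda>(u, x, y, u'). u) (\<lambda>(u, x, y, u'). x)
                            (\<lambda>(u, x, y, u'). y) (\<lambda>(u, x, y, u'). u')"
    and bound: "\<And>u. u \<in> S \<Longrightarrow> pmf (map_pmf fst R) u \<le> m"
  shows "\<P>((u, x, y, u') in measure_pmf R. u = u') \<le> m * (\<Sum>y\<in>UNIV. max_likelihood P y)"
proof -
  let ?U = "\<lambda>(u, x, y, u'). u" and ?X = "\<lambda>(u, x, y, u'). x"
    and ?Y = "\<lambda>(u, x, y, u'). y" and ?V = "\<lambda>(u, x, y, u'). u'"
  define pUX where "pUX u x = measure (measure_pmf R) {w. ?U w = u \<and> ?X w = x}" for u x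
  \<comment> \<open>The guessing kernel. It is 0 throughout if \<open>y\<close> has probability 0,
    which is why \<open>sum_K\<close> claims only a bound by 1.\<close>
  define K where "K y u = \<P>(w in measure_pmf R. ?V w = u \<bar> ?Y w = y)" for y u
  have K_nonneg: "0 \<le> K y u" for y u by (simp add: K_def cond_prob_pmf)
  have pUX_nonneg: "0 \<le> pUX u x" for u x by (simp add: pUX_def)
  have fst_P: "map_pmf ?X R = map_pmf fst P"
    unfolding P[symmetric] map_pmf_comp by (intro map_pmf_cong) auto
  \<comment> \<open>On the support the two Markov conditions factor the mass as P(u,x) P(y|x)
    P(u'|y); the middle factor is then replaced by its maximum over \<open>x\<close>.\<close>
  have point: "pmf R (u, x, y, u') \<le> pUX u x * max_likelihood P y * K y u'" for u x y u'
  proof (cases "0 < pmf R (u, x, y, u')")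
    case True
    let ?a = "measure (measure_pmf R) {w. (?U w = u \<and> ?X w = x) \<and> ?Y w = y}"
    have "pmf R (u, x, y, u') \<le> ?a"
      unfolding measure_pmf_single[symmetric] by (intro measure_pmf.finite_measure_mono) auto
    then have a: "0 < ?a" using True by linarith
    have "?a \<le> pUX u x"
      unfolding pUX_def by (intro measure_pmf.finite_measure_mono) auto
    then have pux: "0 < pUX u x" using a by linarith
    have "pUX u x \<le> measure (measure_pmf R) {w. ?X w = x}"
      unfolding pUX_def by (intro measure_pmf.finite_measure_mono) auto
    then have px: "0 < pmf (map_pmf fst P) x"
      using pux unfolding fst_P[symmetric] pmf_map_conv_measure by linarith
    have "\<P>(w in measure_pmf R. ?Y w = y \<bar> ?U w = u \<and> ?X w = x) = \<P>(w in measure_pmf R. ?Y w = y \<bar> ?X w = x)"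
      using mc pux unfolding markov_chain4_def markov_chain3_def pUX_def by simp
    also have "\<dots> = cond_pmf_snd P y x"
    proof -
      have "pmf P (x, y) = measure (measure_pmf R) {w. ?Y w = y \<and> ?X w = x}"
        unfolding P[symmetric] pmf_map_conv_measure
        by (rule arg_cong[where f = "measure (measure_pmf R)"]) auto
      then show ?thesis
        unfolding cond_prob_pmf cond_pmf_snd_eq fst_P[symmetric] by (simp only: pmf_map_conv_measure)
    qed
    finally have "?a = pUX u x * cond_pmf_snd P y x"
      using pux unfolding cond_prob_pmf pUX_def by (simp add: field_simps conj_commute)
    also have "\<dots> \<le> pUX u x * max_likelihood P y"
      using cond_le_max_likelihood[OF px] pux by simp
    finally have a_le: "?a \<le> pUX u x * max_likelihood P y" .
    \<comment> \<open>Second Markov condition, with past \<open>(u, x)\<close>; it applies because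
      \<open>?a\<close> is positive.\<close>
    have "\<P>(w in measure_pmf R. ?V w = u' \<bar> (?U w, ?X w) = (u, x) \<and> ?Y w = y) = K y u'"
      using mc a unfolding markov_chain4_def markov_chain3_def K_def by simp
    then have "measure (measure_pmf R) {w. ?V w = u' \<and> (?U w, ?X w) = (u, x) \<and> ?Y w = y} = ?a * K y u'"
      using a unfolding cond_prob_pmf by (simp add: field_simps)
    moreover have "{w. ?V w = u' \<and> (?U w, ?X w) = (u, x) \<and> ?Y w = y} = {(u, x, y, u')}" by auto
    ultimately have "pmf R (u, x, y, u') = ?a * K y u'" by (simp add: measure_pmf_single)
    then show ?thesis using mult_right_mono[OF a_le K_nonneg] by simp
  next
    case False
    then have "pmf R (u, x, y, u') = 0" by (metis pmf_pos)
    then show ?thesis by (simp add: pUX_nonneg K_nonneg max_likelihood_nonneg)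
  qed
  have sum_pUX: "(\<Sum>x\<in>UNIV. pUX u x) = pmf (map_pmf fst R) u" for u
    unfolding pUX_def by (subst sum_measure_pmf_fibers)
      (auto simp: pmf_map_conv_measure intro!: arg_cong[where f = "measure (measure_pmf R)"])
  have sum_K: "(\<Sum>u\<in>S. K y u) \<le> 1" for y
  proof -
    have "(\<Sum>u\<in>S. K y u)
        = measure (measure_pmf R) {w. ?Y w = y \<and> ?V w \<in> S} / measure (measure_pmf R) {w. ?Y w = y}"
      unfolding K_def cond_prob_pmf sum_divide_distrib[symmetric]
        sum_measure_pmf_fibers[OF S(1), symmetric] by (simp add: conj_commute)
    also have "\<dots> \<le> 1"
      by (intro divide_le_eq_1[THEN iffD2]) (auto simp: zero_less_measure_iff intro!: measure_pmf.finite_measure_mono)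
    finally show ?thesis .
  qed
  obtain u0 where "u0 \<in> S" using S(2) set_pmf_not_empty[of R] by auto
  then have m: "0 \<le> m" using bound[of u0] pmf_nonneg[of "map_pmf fst R" u0] by linarith
  \<comment> \<open>The diagonal over \<open>S\<close>. It is finite and contains every correct
    guess in the support of \<open>R\<close>, so the success probability is bounded by a finite sum
    of atoms.\<close>
  let ?A = "(\<lambda>(u, x, y). (u, x, y, u)) ` (S \<times> UNIV \<times> UNIV)"
  have "\<P>((u, x, y, u') in measure_pmf R. u = u') = measure (measure_pmf R) {w. ?U w = ?V w}"
    by (simp add: case_prod_unfold)
  also have "\<dots> = measure (measure_pmf R) ({w. ?U w = ?V w} \<inter> set_pmf R)"
    by (simp add: measure_Int_set_pmf)
  also have "\<dots> \<le> measure (measure_pmf R) ?A"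
    using S(2) by (intro measure_pmf.finite_measure_mono) (auto simp: image_iff)
  also have "\<dots> = (\<Sum>a\<in>?A. pmf R a)" using S(1) by (intro measure_measure_pmf_finite) auto
  also have "\<dots> = (\<Sum>(u, x, y)\<in>S \<times> UNIV \<times> UNIV. pmf R (u, x, y, u))"
    by (subst sum.reindex) (auto simp: inj_on_def case_prod_unfold)
  also have "\<dots> \<le> (\<Sum>(u, x, y)\<in>S \<times> UNIV \<times> UNIV. pUX u x * max_likelihood P y * K y u)"
    by (intro sum_mono) (auto simp: point)
  also have "\<dots> = (\<Sum>u\<in>S. \<Sum>x\<in>UNIV. \<Sum>y\<in>UNIV. pUX u x * max_likelihood P y * K y u)"
    by (simp add: sum.cartesian_product)
  \<comment> \<open>Only \<open>pUX\<close> depends on \<open>x\<close>. Summing over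
    \<open>x\<close> first produces the mass of \<open>u\<close>, which is at most \<open>m\<close>;
    after that only \<open>K\<close> depends on \<open>u\<close>.\<close>
  also have "\<dots> = (\<Sum>u\<in>S. \<Sum>y\<in>UNIV. \<Sum>x\<in>UNIV. pUX u x * max_likelihood P y * K y u)"
    by (intro sum.cong refl sum.swap)
  also have "\<dots> = (\<Sum>u\<in>S. \<Sum>y\<in>UNIV. pmf (map_pmf fst R) u * max_likelihood P y * K y u)"
    by (simp add: sum_pUX[symmetric] sum_distrib_right)
  also have "\<dots> \<le> (\<Sum>u\<in>S. \<Sum>y\<in>UNIV. m * max_likelihood P y * K y u)"
    by (intro sum_mono mult_right_mono bound K_nonneg max_likelihood_nonneg)
  also have "\<dots> = (\<Sum>y\<in>UNIV. m * max_likelihood P y * (\<Sum>u\<in>S. K y u))"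
    by (subst sum.swap) (simp add: sum_distrib_left)
  also have "\<dots> \<le> (\<Sum>y\<in>UNIV. m * max_likelihood P y * 1)"
    by (intro sum_mono mult_left_mono sum_K mult_nonneg_nonneg m max_likelihood_nonneg)
  finally show ?thesis by (simp add: sum_distrib_left)
qed

lemma maximal_leakage_le:
  fixes P :: "('x::finite \<times> 'y::finite) pmf"
  shows "maximal_leakage P \<le> ereal (ln (\<Sum>y\<in>UNIV. max_likelihood P y))"
  unfolding maximal_leakage_def
proof (rule Sup_least, clarify)
  fix R :: "(nat \<times> 'x \<times> 'y \<times> nat) pmf" and S
  assume S: "finite S" "set_pmf R \<subseteq> S \<times> UNIV \<times> UNIV \<times> S"
    and P: "P = map_pmf (\<lambda>(u, x, y, u'). (x, y)) R"
    and mc: "markov_chain4 R (\<lambda>(u, x, y, u'). u) (\<lambda>(u, x, y, u'). x)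
                            (\<lambda>(u, x, y, u'). y) (\<lambda>(u, x, y, u'). u')"
  let ?m = "MAX u\<in>S. pmf (map_pmf fst R) u"
  let ?p = "\<P>((u, x, y, u') in measure_pmf R. u = u')"
  have bound: "pmf (map_pmf fst R) u \<le> ?m" if "u \<in> S" for u using S that by simp
  \<comment> \<open>An atom of positive mass lies in \<open>S\<close>, so the maximum in the
    denominator is positive.\<close>
  obtain u where u: "0 < pmf (map_pmf fst R) u" using pmf_pos_ex[of "map_pmf fst R"] by auto
  then have "u \<in> S" using S(2) by (auto simp: pmf_positive_iff)
  then have m: "0 < ?m" using u bound[of u] by linarith
  have "?p \<le> ?m * (\<Sum>y\<in>UNIV. max_likelihood P y)"
    by (rule guess_prob_le[OF S P[symmetric] mc bound])
  then have "?p / ?m \<le> (\<Sum>y\<in>UNIV. max_likelihood P y)"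
    using m by (simp add: divide_le_eq mult.commute)
  from eln_mono[OF ennreal_leI[OF this]]
  show "eln (ennreal (?p / ?m))
      \<le> ereal (ln (\<Sum>y\<in>UNIV. max_likelihood (map_pmf (\<lambda>(u, x, y, u'). (x, y)) R) y))"
    using sum_max_likelihood_pos[of P] by (simp add: eln_ennreal P)
qed

section \<open>An optimal guessing problem\<close>

text \<open>With probability \<open>a\<close> take 0, otherwise a uniform element of
  \<open>{1..n}\<close>. This splits a symbol into one atom of prescribed share and \<open>n\<close>
  small ones.\<close>

lemma ex_split_pmf:
  assumes "0 \<le> a" "a \<le> 1" "0 < n"
  shows "\<exists>q :: nat pmf. pmf q 0 = a \<and> set_pmf q \<subseteq> {..n} \<and> (\<forall>i. i \<noteq> 0 \<longrightarrow> pmf q i \<le> (1 - a) / n)"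
proof -
  let ?q = "bind_pmf (bernoulli_pmf a) (\<lambda>b. if b then return_pmf 0 else pmf_of_set {1..n})"
  have "pmf ?q 0 = a" "\<forall>i. i \<noteq> 0 \<longrightarrow> pmf ?q i \<le> (1 - a) / n" "set_pmf ?q \<subseteq> {..n}"
    using assms by (auto simp: pmf_bind pmf_of_set indicator_def split: if_splits)
  then show ?thesis by blast
qed

lemma pmf_bind_Pair: "pmf (bind_pmf P (\<lambda>z. map_pmf (Pair z) (K z))) (z, i) = pmf P z * pmf (K z) i"
proof -
  have "pmf (map_pmf (Pair z') (K z')) (z, i) = pmf (K z) i * indicator {z} z'" for z'
    by (cases "z' = z") (auto simp: pmf_map_inj' inj_on_def pmf_map vimage_def measure_pmf_single)
  then show ?thesis by (simp add: pmf_bind measure_pmf_single)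
qed

text \<open>Once \<open>B\<close> is known, \<open>C\<close> is almost surely determined, so both
  conditional probabilities are the same indicator.\<close>

lemma markov_chain3_function:
  assumes "\<And>w. w \<in> set_pmf R \<Longrightarrow> C w = g (B w)"
  shows "markov_chain3 R A B C"
  unfolding markov_chain3_def
proof (intro allI impI)
  \<comment> \<open>The event \<open>D\<close> is left free so that one computation covers both
    sides: \<open>D\<close> is \<open>A w = a\<close> on the left and trivially true on the
    right.\<close>
  have *: "\<P>(w in measure_pmf R. C w = c \<bar> D w \<and> B w = b) = (if g b = c then 1 else 0)"
    if "0 < measure (measure_pmf R) {w. D w \<and> B w = b}" for D b c
  proof -
    have "measure (measure_pmf R) {w. C w = c \<and> D w \<and> B w = b}
        = measure (measure_pmf R) (if g b = c then {w. D w \<and> B w = b} else {})"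
      using assms by (intro measure_pmf.finite_measure_eq_AE AE_pmfI) auto
    then show ?thesis using that by (simp add: cond_prob_pmf)
  qed
  fix a b c
  assume pos: "0 < \<P>(w in measure_pmf R. A w = a \<and> B w = b)"
  also have "\<dots> \<le> measure (measure_pmf R) {w. True \<and> B w = b}"
    by (auto intro: measure_pmf.finite_measure_mono)
  finally show "\<P>(w in measure_pmf R. C w = c \<bar> A w = a \<and> B w = b) = \<P>(w in measure_pmf R. C w = c \<bar> B w = b)"
    using *[of "\<lambda>w. A w = a" b c] *[of "\<lambda>_. True" b c] pos by simp
qed

lemma le_maximal_leakage:
  fixes P :: "('x::finite \<times> 'y::finite) pmf"
  shows "ereal (ln (\<Sum>y\<in>UNIV. max_likelihood P y)) \<le> maximal_leakage P"
proof -
  let ?L = "\<Sum>y\<in>UNIV. max_likelihood P y"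
  let ?px = "pmf (map_pmf fst P)"
  define m where "m = Min (?px ` {x. 0 < ?px x})"
  have ne: "{x. 0 < ?px x} \<noteq> {}" using pmf_pos_ex[of "map_pmf fst P"] by auto
  have m_le: "m \<le> ?px x" if "0 < ?px x" for x unfolding m_def using that by (intro Min_le) auto
  have "m \<in> ?px ` {x. 0 < ?px x}" unfolding m_def using ne by (intro Min_in) auto
  then obtain x1 where x1: "0 < ?px x1" "?px x1 = m" by auto
  then have m: "0 < m" by simp
  \<comment> \<open>Large enough that each of the \<open>n\<close> small atoms, of mass at most
    \<open>1 / n\<close>, stays below \<open>m\<close>.\<close>
  define n where "n = nat \<lceil>1 / m\<rceil>"
  have n: "1 / m \<le> real n" unfolding n_def by linarith
  have "0 < 1 / m" using m by simp
  then have n0: "0 < n" using n by (cases n) auto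
  have "\<exists>q :: nat pmf. set_pmf q \<subseteq> {..n} \<and> (0 < ?px x \<longrightarrow> ?px x * pmf q 0 = m \<and> (\<forall>i. ?px x * pmf q i \<le> m))" for x
  proof (cases "0 < ?px x")
    case True
    \<comment> \<open>The share of atom 0 within \<open>x\<close> is \<open>m / ?px x\<close>, which
      is at most 1 by minimality of \<open>m\<close>.\<close>
    then have a: "m / ?px x \<le> 1" "0 \<le> m / ?px x" using m_le[OF True] m by auto
    obtain q :: "nat pmf" where q: "pmf q 0 = m / ?px x" "set_pmf q \<subseteq> {..n}"
      "\<And>i. i \<noteq> 0 \<Longrightarrow> pmf q i \<le> (1 - m / ?px x) / n"
      using ex_split_pmf[OF a(2,1) n0] by blast
    have "?px x * pmf q i \<le> m" if "i \<noteq> 0" for i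
    proof -
      have "?px x * pmf q i \<le> 1 * (1 / n)"
        using q(3)[OF that] a n0 by (intro mult_mono order.trans[OF q(3)[OF that]] divide_right_mono) (auto simp: pmf_le_1)
      also have "\<dots> \<le> m" using n m n0 by (simp add: field_simps)
      finally show ?thesis .
    qed
    moreover have "?px x * pmf q 0 = m" using q True by simp
    ultimately have "\<forall>i. ?px x * pmf q i \<le> m" by (metis order_refl)
    then show ?thesis using q \<open>?px x * pmf q 0 = m\<close> by blast
  next
    case False
    \<comment> \<open>Off the support any law on \<open>{..n}\<close> would do.\<close>
    then show ?thesis by (intro exI[of _ "return_pmf 0"]) auto
  qed
  then obtain q :: "'x \<Rightarrow> nat pmf" where q_supp: "\<And>x. set_pmf (q x) \<subseteq> {..n}"
    and q0: "\<And>x. 0 < ?px x \<Longrightarrow> ?px x * pmf (q x) 0 = m"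
    and q_le: "\<And>x i. 0 < ?px x \<Longrightarrow> ?px x * pmf (q x) i \<le> m" by metis
  obtain g where g: "\<And>y. 0 < ?px (g y)" "\<And>y. max_likelihood P y = cond_pmf_snd P y (g y)"
    using max_likelihood_attained[of P] by metis
  \<comment> \<open>An injection of the refined symbols \<open>(x, i)\<close> into the natural
    numbers, where the alphabets of \<open>maximal_leakage\<close> live.\<close>
  define code :: "'x \<times> nat \<Rightarrow> nat" where "code = to_nat"
  have code: "code a = code b \<longleftrightarrow> a = b" for a b by (simp add: code_def)
  \<comment> \<open>The index \<open>i\<close> is drawn from \<open>(x, y)\<close> through
    \<open>x\<close> alone, which gives the first Markov condition. \<open>F\<close> then adds the
    guess \<open>(g y, 0)\<close>, where \<open>g\<close> is the maximum-likelihood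
    estimate.\<close>
  define B where "B = bind_pmf P (\<lambda>z. map_pmf (Pair z) (q (fst z)))"
  define F where "F = (\<lambda>((x, y), i). (code (x, i), x, y, code (g y, 0)))"
  define R where "R = map_pmf F B"
  define S where "S = code ` (UNIV \<times> {..n})"
  have pmf_B: "pmf B ((x, y), i) = pmf P (x, y) * pmf (q x) i" for x y i
    by (simp add: B_def pmf_bind_Pair)
  have meas_R: "measure (measure_pmf R) {w. Q w} = measure (measure_pmf B) {w. Q (F w)}" for Q
    by (simp add: R_def vimage_def)
  have map_R: "pmf (map_pmf f R) a = measure (measure_pmf B) {w. f (F w) = a}" for f :: "_ \<Rightarrow> 'z" and a
    by (simp add: pmf_map_conv_measure meas_R)
  have R_xy: "map_pmf (\<lambda>(u, x, y, u'). (x, y)) R = P"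
  proof -
    have "map_pmf (\<lambda>(u, x, y, u'). (x, y)) R = map_pmf fst B"
      unfolding R_def map_pmf_comp by (intro map_pmf_cong) (auto simp: F_def)
    also have "\<dots> = P" by (simp add: B_def map_bind_pmf map_pmf_comp bind_return_pmf')
    finally show ?thesis .
  qed
  have supp_B: "set_pmf B \<subseteq> UNIV \<times> {..n}" using q_supp by (auto simp: B_def)
  have R_supp: "set_pmf R \<subseteq> S \<times> UNIV \<times> UNIV \<times> S"
    using supp_B by (auto simp: R_def S_def F_def)
  have S: "finite S" by (simp add: S_def)
  have xi: "measure (measure_pmf B) {w. fst (fst w) = x \<and> snd w = i} = ?px x * pmf (q x) i" for x i
  proof -
    have "measure (measure_pmf B) {w. (fst (fst w) = x \<and> snd w = i) \<and> snd (fst w) = y}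
        = pmf P (x, y) * pmf (q x) i" for y
    proof -
      have "{w. (fst (fst w) = x \<and> snd w = i) \<and> snd (fst w) = y} = {((x, y), i)}" by auto
      then show ?thesis by (simp add: measure_pmf_single pmf_B)
    qed
    then show ?thesis
      using sum_measure_pmf_fibers[of UNIV B "\<lambda>w. fst (fst w) = x \<and> snd w = i" "\<lambda>w. snd (fst w)"]
      by (simp add: pmf_fst_eq_sum sum_distrib_right)
  qed
  have R_u: "pmf (map_pmf fst R) (code (x, i)) = ?px x * pmf (q x) i" for x i
    by (simp add: map_R F_def case_prod_unfold code xi)
  have max_U: "(MAX u\<in>S. pmf (map_pmf fst R) u) = m"
  proof (rule Max_eqI)
    show "finite ((\<lambda>u. pmf (map_pmf fst R) u) ` S)" using S by simp
    show "v \<le> m" if v: "v \<in> (\<lambda>u. pmf (map_pmf fst R) u) ` S" for v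
    proof -
      obtain a where "v = pmf (map_pmf fst R) (code a)" using v unfolding S_def by blast
      then obtain x i where xi: "v = ?px x * pmf (q x) i" using R_u by (cases a) auto
      consider "0 < ?px x" | "?px x = 0" by (metis pmf_pos)
      then show ?thesis using q_le[of x i] m by cases (auto simp: xi)
    qed
    show "m \<in> (\<lambda>u. pmf (map_pmf fst R) u) ` S"
      using R_u[of x1 0] q0[of x1] x1 by (intro image_eqI[of _ _ "code (x1, 0)"]) (auto simp: S_def)
  qed
  let ?p = "\<P>((u, x, y, u') in measure_pmf R. u = u')"
  have "?p = measure (measure_pmf R) {w. (\<lambda>(u, x, y, u'). u = u') w}" by simp
  \<comment> \<open>A guess is correct exactly when \<open>x = g y\<close> and \<open>i = 0\<close>:
    one atom for each \<open>y\<close>.\<close>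
  also have "\<dots> = measure (measure_pmf B) {w. w \<in> (\<lambda>y. ((g y, y), 0)) ` UNIV}"
    unfolding meas_R by (rule arg_cong[where f = "measure (measure_pmf B)"])
      (auto simp: F_def code image_iff)
  also have "\<dots> = (\<Sum>w\<in>(\<lambda>y. ((g y, y), 0)) ` UNIV. pmf B w)"
    by (simp add: measure_measure_pmf_finite)
  also have "\<dots> = (\<Sum>y\<in>UNIV. pmf P (g y, y) * pmf (q (g y)) 0)"
    by (subst sum.reindex) (auto simp: inj_on_def pmf_B)
  also have "\<dots> = (\<Sum>y\<in>UNIV. m * max_likelihood P y)"
  proof (intro sum.cong refl)
    fix y
    \<comment> \<open>The joint mass is the mass of \<open>g y\<close> times the maximum at
      \<open>y\<close>, and the mass of \<open>g y\<close> times the share of atom 0 is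
      \<open>m\<close>.\<close>
    show "pmf P (g y, y) * pmf (q (g y)) 0 = m * max_likelihood P y"
      using q0[OF g(1)[of y]] g(1)[of y] by (simp add: g(2) cond_pmf_snd_eq field_simps)
  qed
  finally have p: "?p / m = ?L" using m by (simp add: sum_distrib_left[symmetric])
  have mc1: "markov_chain3 R (\<lambda>(u, x, y, u'). u) (\<lambda>(u, x, y, u'). x) (\<lambda>(u, x, y, u'). y)"
    unfolding markov_chain3_def
  proof (intro allI impI)
    fix u x y
    assume "0 < \<P>(w in measure_pmf R. (case w of (u, x, y, u') \<Rightarrow> u) = u \<and> (case w of (u, x, y, u') \<Rightarrow> x) = x)"
    moreover have "{w. (case F w of (u, x, y, u') \<Rightarrow> u) = u \<and> (case F w of (u, x, y, u') \<Rightarrow> x) = x}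
        = {w. code (x, snd w) = u \<and> fst (fst w) = x}"
      by (auto simp: F_def)
    ultimately have pos: "0 < measure (measure_pmf B) {w. code (x, snd w) = u \<and> fst (fst w) = x}"
      by (simp add: meas_R)
    \<comment> \<open>Otherwise the conditioning event would be empty, against its positive
      probability.\<close>
    obtain i where u: "u = code (x, i)"
    proof (rule ccontr)
      assume "\<not> thesis"
      then have "{w :: ('x \<times> 'y) \<times> nat. code (x, snd w) = u \<and> fst (fst w) = x} = {}" using that by auto
      then show False using pos by (simp only: measure_empty less_irrefl)
    qed
    have ux: "measure (measure_pmf R) {w. (case w of (u, x, y, u') \<Rightarrow> u) = u \<and> (case w of (u, x, y, u') \<Rightarrow> x) = x}
        = ?px x * pmf (q x) i"
      unfolding meas_R xi[symmetric] by (rule arg_cong[where f = "measure (measure_pmf B)"])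
        (auto simp: F_def u code)
    have uxy: "measure (measure_pmf R) {w. (case w of (u, x, y, u') \<Rightarrow> y) = y \<and>
        (case w of (u, x, y, u') \<Rightarrow> u) = u \<and> (case w of (u, x, y, u') \<Rightarrow> x) = x} = pmf P (x, y) * pmf (q x) i"
      unfolding meas_R pmf_B[symmetric] measure_pmf_single[of B, symmetric]
      by (rule arg_cong[where f = "measure (measure_pmf B)"]) (auto simp: F_def u code)
    have xy: "measure (measure_pmf R) {w. (case w of (u, x, y, u') \<Rightarrow> y) = y \<and> (case w of (u, x, y, u') \<Rightarrow> x) = x}
        = pmf P (x, y)"
      unfolding R_xy[symmetric] pmf_map_conv_measure
      by (rule arg_cong[where f = "measure (measure_pmf R)"]) auto
    have x: "measure (measure_pmf R) {w. (case w of (u, x, y, u') \<Rightarrow> x) = x} = ?px x"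
      unfolding R_xy[symmetric] map_pmf_comp pmf_map_conv_measure
      by (rule arg_cong[where f = "measure (measure_pmf R)"]) auto
    \<comment> \<open>Conditioning on \<open>u\<close> multiplies numerator and denominator by this
      same factor, which therefore cancels.\<close>
    have "pmf (q x) i \<noteq> 0" using pos u xi[of x i] by (auto simp: code conj_commute)
    then show "\<P>(w in measure_pmf R. (case w of (u, x, y, u') \<Rightarrow> y) = y \<bar>
          (case w of (u, x, y, u') \<Rightarrow> u) = u \<and> (case w of (u, x, y, u') \<Rightarrow> x) = x)
        = \<P>(w in measure_pmf R. (case w of (u, x, y, u') \<Rightarrow> y) = y \<bar> (case w of (u, x, y, u') \<Rightarrow> x) = x)"
      unfolding cond_prob_pmf ux uxy xy x by simp
  qed
  \<comment> \<open>The remaining condition holds because the guess is a function of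
    \<open>y\<close>.\<close>
  have mc2: "markov_chain4 R (\<lambda>(u, x, y, u'). u) (\<lambda>(u, x, y, u'). x) (\<lambda>(u, x, y, u'). y) (\<lambda>(u, x, y, u'). u')"
    unfolding markov_chain4_def using mc1
    by (auto simp: R_def F_def intro!: markov_chain3_function[where g = "\<lambda>y. code (g y, 0)"])
  have "ereal (ln ?L) = eln (ennreal (?p / (MAX u\<in>S. pmf (map_pmf fst R) u)))"
    unfolding max_U p by (simp add: eln_ennreal sum_max_likelihood_pos)
  then show ?thesis
    unfolding maximal_leakage_def using S R_supp R_xy mc2 by (intro Sup_upper) blast
qed

theorem theorem1:
  fixes P :: "('x::finite \<times> 'y::finite) pmf"
  shows "maximal_leakage P =
           ereal (ln (\<Sum>y\<in>UNIV. MAX x\<in>{x. pmf (map_pmf fst P) x > 0}. cond_pmf_snd P y x)) \<and>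
         ereal (ln (\<Sum>y\<in>UNIV. MAX x\<in>{x. pmf (map_pmf fst P) x > 0}. cond_pmf_snd P y x)) =
           sibson_information_inf P"
  using antisym[OF maximal_leakage_le le_maximal_leakage, of P] sibson_information_inf_eq[of P]
  by (simp add: max_likelihood_def)

end
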